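(* Let $r\ge 1$. For $1\le j\le r$ let $G_j=(V_j,E_j)$ be a connected graph on $|V_j|\ge 2$ vertices ($|V_j|=\infty$ may happen) with a distinguished vertex $o_j\in V_j$. Assume that every $G_j$ is of QE class with QE constant $Q_j=\mathrm{QEC}(G_j)\le 0$. If $Q_j=0$ for some $j$, then $\mathrm{QEC}(G_1\star\dots\star G_r)=0$.
   Context: Graphs are undirected and may be finite or infinite. For a connected graph $G=(V,E)$, $d(x,y)$ denotes the graph distance (length of a shortest path) and $D=[d(x,y)]_{x,y\in V}$ the distance matrix. $C_0(V)$ is the space of real-valued functions on $V$ with finite support, $\langle f,g\rangle=\sum_{x\in V}f(x)g(x)$, and $\langle \mathbf 1,f\rangle=\sum_{x\in V}f(x)$. The QE constant (quadratic embedding constant) is $\mathrm{QEC}(G)=\sup\{\langle f,Df\rangle : f\in C_0(V),\ \langle f,f\rangle=1,\ \langle\mathbf 1,f\rangle=0\}$. $G$ is of QE class if there is a map $\varphi$ from $V$ into a real Hilbert space with $\|\varphi(x)-\varphi(y)\|^2=d(x,y)$ for all $x,y\in V$ (equivalently, $\mathrm{QEC}(G)\le 0$). Given connected graphs $G_j=(V_j,E_j)$ with distinguished vertices $o_j\in V_j$, $1\le j\le r$, the star product $G_1\star\dots\star G_r$ is the graph obtained from the disjoint union of the $G_j$ by identifying (glueing) all the vertices $o_1,\dots,o_r$ to a single vertex $o$. *)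

theory Defs
  imports
    "HOL-Analysis.Inner_Product"
    "HOL-Analysis.Infinite_Sum"
    "Graph_Theory.Digraph_Component"
    "Graph_Theory.Shortest_Path"
begin

text \<open>
  An undirected (simple, finite or infinite) graph is a symmetric, irreflexive arc relation on a
  vertex set, i.e. a \<^typ>\<open>'a pair_pre_digraph\<close> satisfying \<^locale>\<open>pair_bidirected_digraph\<close>.
\<close>

text \<open>
  The graph distance is the least cost of a walk with unit arc costs. On a connected graph the
  infimum is a finite minimum, so the coercion from \<^typ>\<open>ereal\<close> loses nothing.
\<close>

definition gdist :: "'a pair_pre_digraph \<Rightarrow> 'a \<Rightarrow> 'a \<Rightarrow> real" where
  "gdist G x y = real_of_ereal (wf_digraph.\<mu> (with_proj G) (\<lambda>_. 1) x y)"

definition fin_supp_funs :: "'a set \<Rightarrow> ('a \<Rightarrow> real) set" where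
  "fin_supp_funs V = {f. finite {x. f x \<noteq> 0} \<and> {x. f x \<noteq> 0} \<subseteq> V}"

text \<open>
  Sums over the possibly infinite vertex set are written with \<^const>\<open>infsum\<close>, because
  \<^const>\<open>sum\<close> is 0 on infinite sets. Below, all of them have only finitely many nonzero terms.
\<close>

definition pairing :: "'a set \<Rightarrow> ('a \<Rightarrow> real) \<Rightarrow> ('a \<Rightarrow> real) \<Rightarrow> real" where
  "pairing V f g = (\<Sum>\<^sub>\<infinity>x\<in>V. f x * g x)"

definition dist_op :: "'a pair_pre_digraph \<Rightarrow> ('a \<Rightarrow> real) \<Rightarrow> 'a \<Rightarrow> real" where
  "dist_op G f x = (\<Sum>\<^sub>\<infinity>y\<in>pverts G. gdist G x y * f y)"

text \<open>
  The supremum is taken in \<^typ>\<open>ereal\<close>: on an infinite graph it need not be finite.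
\<close>

definition QEC :: "'a pair_pre_digraph \<Rightarrow> ereal" where
  "QEC G = (SUP f \<in> {f \<in> fin_supp_funs (pverts G).
                      pairing (pverts G) f f = 1 \<and> pairing (pverts G) (\<lambda>_. 1) f = 0}.
              ereal (pairing (pverts G) f (dist_op G f)))"

text \<open>
  HOL cannot quantify over types inside a formula, so the Hilbert space is a type parameter
  \<open>'h\<close>. As a hypothesis of a theorem with \<open>'h\<close> free, this expresses that some real Hilbert
  space admits such a map. For a finite family of graphs one \<open>'h\<close> suffices: each of
  finitely many Hilbert spaces embeds isometrically into their direct sum.
\<close>

definition qe_class :: "'h::{real_inner,complete_space} itself \<Rightarrow> 'a pair_pre_digraph \<Rightarrow> bool" where
  "qe_class (_ :: 'h itself) G \<longleftrightarrow>
     (\<exists>\<phi> :: 'a \<Rightarrow> 'h. \<forall>x\<in>pverts G. \<forall>y\<in>pverts G. (norm (\<phi> x - \<phi> y))\<^sup>2 = gdist G x y)"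

definition disjoint_union_graph ::
  "'i set \<Rightarrow> ('i \<Rightarrow> 'a pair_pre_digraph) \<Rightarrow> ('i \<times> 'a) pair_pre_digraph" where
  "disjoint_union_graph I G =
     \<lparr> pverts = (SIGMA j:I. pverts (G j)),
       parcs = {((j, x), (j, y)) | j x y. j \<in> I \<and> (x, y) \<in> parcs (G j)} \<rparr>"

text \<open>
  The quotient of a graph in which the vertices in \<open>S\<close> are identified to a single vertex; the
  vertices of the quotient are the equivalence classes.
\<close>

definition glue_class :: "'a set \<Rightarrow> 'a \<Rightarrow> 'a set" where
  "glue_class S x = (if x \<in> S then S else {x})"

definition glue_graph :: "'a set \<Rightarrow> 'a pair_pre_digraph \<Rightarrow> 'a set pair_pre_digraph" where
  "glue_graph S G =
     \<lparr> pverts = glue_class S ` pverts G,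
       parcs = (\<lambda>(x, y). (glue_class S x, glue_class S y)) ` parcs G \<rparr>"

definition star_product ::
  "'i set \<Rightarrow> ('i \<Rightarrow> 'a pair_pre_digraph) \<Rightarrow> ('i \<Rightarrow> 'a) \<Rightarrow> ('i \<times> 'a) set pair_pre_digraph" where
  "star_product I G ov = glue_graph ((\<lambda>j. (j, ov j)) ` I) (disjoint_union_graph I G)"

end

theory Submission
  imports Defs
begin

text \<open>
  Write \<open>d\<close> for the distance of the star product and, for each factor \<open>k\<close>, let \<open>\<pi>\<^sub>k\<close> be the
  retraction onto \<open>G\<^sub>k\<close> that sends all the other factors to the base point \<open>o\<^sub>k\<close>. A path between
  two different factors has to pass through the common vertex, and this makes the distance
  \<^emph>\<open>additive\<close> over the factors:
  \<open>d(p, q) = (\<Sum>k. d\<^sub>k(\<pi>\<^sub>k p, \<pi>\<^sub>k q))\<close>, which is \<open>gdist_star\<close> below.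

  Upper bound. For \<open>f\<close> of finite support with \<open>\<langle>1, f\<rangle> = 0\<close>, additivity splits \<open>\<langle>f, D f\<rangle>\<close> into the
  sums \<open>\<Sum>p q. f(p) f(q) d\<^sub>k(\<pi>\<^sub>k p, \<pi>\<^sub>k q)\<close>. If \<open>d\<^sub>k(x, y) = \<parallel>\<phi>\<^sub>k x - \<phi>\<^sub>k y\<parallel>\<^sup>2\<close>, expanding the square
  shows that the \<open>k\<close>-th sum equals \<open>- 2 \<parallel>\<Sum>p. f(p) \<phi>\<^sub>k(\<pi>\<^sub>k p)\<parallel>\<^sup>2\<close>, because the two unmixed terms
  carry the factor \<open>\<langle>1, f\<rangle>\<close>. So every summand is nonpositive, and the QE constant of the
  star product is at most 0.

  Lower bound. Additivity also shows that each \<open>G\<^sub>j\<close> sits isometrically in the star product, and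
  extending a test function by zero along an isometric embedding changes neither the constraints
  nor the value of the form, so the QE constant is monotone under such embeddings. A
  factor with constant 0 therefore forces the constant of the star product to be at least 0.
\<close>

section \<open>Graph distance via walks\<close>

text \<open>
  Connectedness is expressed through walks, and a walk of length \<open>n\<close> through the \<open>n\<close>-th relation
  power of the arc set, so that walks can be concatenated and mapped without handling arc lists.
\<close>

locale connected_pair_digraph = pair_wf_digraph G for G :: "'a pair_pre_digraph" +
  assumes walk_ex: "\<lbrakk>x \<in> pverts G; y \<in> pverts G\<rbrakk> \<Longrightarrow> (x, y) \<in> (parcs G)\<^sup>*"

lemma (in pair_wf_digraph) awalk_imp_relpow:
  assumes "awalk x p y"
  shows "(x, y) \<in> parcs G ^^ length p"
  using assms
proof (induction p arbitrary: x)
  case Nil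
  then show ?case by (simp add: awalk_Nil_iff)
next
  case (Cons e p)
  then show ?case
    by (cases e) (auto simp: awalk_Cons_iff simp del: relpow.simps intro: relpow_Suc_I2)
qed

lemma (in pair_wf_digraph) relpow_imp_awalk:
  assumes "x \<in> pverts G" "(x, y) \<in> parcs G ^^ n"
  shows "\<exists>p. awalk x p y \<and> length p = n"
  using assms
proof (induction n arbitrary: x)
  case 0
  then show ?case by (auto simp: awalk_Nil_iff)
next
  case (Suc n)
  from Suc.prems(2) obtain z where z: "(x, z) \<in> parcs G" "(z, y) \<in> parcs G ^^ n"
    by (meson relpow_Suc_D2)
  then obtain p where p: "awalk z p y" "length p = n"
    using Suc.IH in_arcsD2 by blast
  then have "awalk x ((x, z) # p) y"
    using z(1) by (simp add: awalk_Cons_iff)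
  then show ?case using p(2) by (metis length_Cons)
qed

text \<open>
  With unit costs, the costs of walks are natural numbers, so the infimum in \<open>\<mu>\<close> is attained by a
  walk of least length.
\<close>

lemma (in pair_wf_digraph) gdist_eq_Least:
  assumes x: "x \<in> pverts G" and walk: "(x, y) \<in> (parcs G)\<^sup>*"
  shows "gdist G x y = real (LEAST n. (x, y) \<in> parcs G ^^ n)"
proof -
  let ?m = "LEAST n. (x, y) \<in> parcs G ^^ n"
  have cost: "awalk_cost (\<lambda>_. 1) p = real (length p)" for p :: "('a \<times> 'a) awalk"
    by (induction p) auto
  obtain n where "(x, y) \<in> parcs G ^^ n"
    using walk rtrancl_imp_relpow by metis
  then have "(x, y) \<in> parcs G ^^ ?m" by (rule LeastI)
  then obtain p where p: "awalk x p y" "length p = ?m"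
    using relpow_imp_awalk[OF x] by blast
  have "\<mu> (\<lambda>_. 1) x y = ereal (real ?m)"
  proof (rule antisym)
    show "\<mu> (\<lambda>_. 1) x y \<le> ereal (real ?m)"
      using min_cost_le_walk_cost[OF p(1), of "\<lambda>_. 1"] by (simp add: cost p(2))
    show "ereal (real ?m) \<le> \<mu> (\<lambda>_. 1) x y"
      unfolding \<mu>_def
      by (rule INF_greatest) (auto simp: cost intro: Least_le dest: awalk_imp_relpow)
  qed
  then show ?thesis by (simp add: gdist_def)
qed

context connected_pair_digraph
begin

lemma gdist_le_length:
  assumes "x \<in> pverts G" "(x, y) \<in> parcs G ^^ n"
  shows "gdist G x y \<le> real n"
  using gdist_eq_Least[OF assms(1) relpow_imp_rtrancl[OF assms(2)]] assms(2)
  by (simp add: Least_le)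

lemma gdist_attained:
  assumes "x \<in> pverts G" "y \<in> pverts G"
  obtains n where "(x, y) \<in> parcs G ^^ n" "gdist G x y = real n"
proof -
  obtain n where "(x, y) \<in> parcs G ^^ n"
    using walk_ex[OF assms] rtrancl_imp_relpow by metis
  then have "(x, y) \<in> parcs G ^^ (LEAST n. (x, y) \<in> parcs G ^^ n)" by (rule LeastI)
  then show thesis
    using that gdist_eq_Least[OF assms(1) walk_ex[OF assms]] by blast
qed

lemma gdist_refl: "x \<in> pverts G \<Longrightarrow> gdist G x x = 0"
  by (subst gdist_eq_Least) auto

lemma gdist_arc: "(x, y) \<in> parcs G \<Longrightarrow> gdist G x y \<le> 1"
  using gdist_le_length[of x y 1] in_arcsD1[of x y] by simp

lemma gdist_triangle:
  assumes "x \<in> pverts G" "y \<in> pverts G" "z \<in> pverts G"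
  shows "gdist G x z \<le> gdist G x y + gdist G y z"
proof -
  obtain m where m: "(x, y) \<in> parcs G ^^ m" "gdist G x y = real m"
    using gdist_attained assms(1,2) by blast
  obtain n where n: "(y, z) \<in> parcs G ^^ n" "gdist G y z = real n"
    using gdist_attained assms(2,3) by blast
  have "(x, z) \<in> parcs G ^^ (m + n)"
    using m(1) n(1) by (auto simp: relpow_add)
  from gdist_le_length[OF assms(1) this] show ?thesis
    by (simp add: m(2) n(2))
qed

text \<open>
  The graph distance is the largest function that vanishes on the diagonal, is at most 1 on arcs
  and satisfies the triangle inequality: such a function grows by at most 1 along each arc of a
  shortest walk. This is how distances in the star product are bounded from below.
\<close>

lemma le_gdist:
  assumes refl: "\<And>x. x \<in> pverts G \<Longrightarrow> \<rho> x x \<le> 0"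
    and arc: "\<And>x y. (x, y) \<in> parcs G \<Longrightarrow> \<rho> x y \<le> 1"
    and triangle: "\<And>x y z. \<lbrakk>x \<in> pverts G; y \<in> pverts G; z \<in> pverts G\<rbrakk>
                     \<Longrightarrow> \<rho> x z \<le> \<rho> x y + \<rho> y z"
    and xy: "x \<in> pverts G" "y \<in> pverts G"
  shows "\<rho> x y \<le> gdist G x y"
proof -
  have walk: "z \<in> pverts G \<and> \<rho> x z \<le> real n" if "(x, z) \<in> parcs G ^^ n" for n z
    using that
  proof (induction n arbitrary: z)
    case 0
    then show ?case using refl xy(1) by simp
  next
    case (Suc n)
    then obtain w where w: "(x, w) \<in> parcs G ^^ n" "(w, z) \<in> parcs G" by auto
    have "z \<in> pverts G" using w(2) by (rule in_arcsD2)
    moreover have "\<rho> x z \<le> \<rho> x w + \<rho> w z"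
      using triangle xy(1) Suc.IH[OF w(1)] \<open>z \<in> pverts G\<close> by blast
    ultimately show ?case
      using Suc.IH[OF w(1)] arc[OF w(2)] by simp
  qed
  obtain n where "(x, y) \<in> parcs G ^^ n" "gdist G x y = real n"
    using gdist_attained xy by blast
  then show ?thesis using walk by simp
qed

text \<open>
  The pull-back of the distance of \<open>H\<close> along a homomorphism meets the three conditions of
  \<open>le_gdist\<close>.
\<close>

lemma gdist_hom_le:
  assumes H: "connected_pair_digraph H"
    and verts: "\<And>x. x \<in> pverts G \<Longrightarrow> h x \<in> pverts H"
    and arcs: "\<And>x y. (x, y) \<in> parcs G \<Longrightarrow> (h x, h y) \<in> parcs H"
    and xy: "x \<in> pverts G" "y \<in> pverts G"
  shows "gdist H (h x) (h y) \<le> gdist G x y"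
proof -
  interpret H: connected_pair_digraph H by (rule H)
  show ?thesis
    by (rule le_gdist[where \<rho> = "\<lambda>x y. gdist H (h x) (h y)"])
       (use xy in \<open>auto simp: H.gdist_refl verts arcs intro!: H.gdist_arc H.gdist_triangle\<close>)
qed

end

lemma connected_pair_digraphI:
  assumes "pair_sym_digraph G" "Digraph_Component.connected (with_proj G)"
  shows "connected_pair_digraph G"
proof -
  interpret pair_sym_digraph G by fact
  show ?thesis
  proof
    fix x y assume "x \<in> pverts G" "y \<in> pverts G"
    then have "x \<rightarrow>\<^sup>*\<^bsub>with_proj (mk_symmetric (with_proj G))\<^esub> y"
      using assms(2) unfolding connected_def strongly_connected_def by simp
    then have "x \<rightarrow>\<^sup>*\<^bsub>with_proj G\<^esub> y"
      by (simp add: reachable_mk_symmetric_eq[OF sym_arcs])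
    then have "(x, y) \<in> (arcs_ends (with_proj G))\<^sup>*"
      by (rule reachable_rtranclI)
    then show "(x, y) \<in> (parcs G)\<^sup>*"
      by (simp add: arcs_ends_conv)
  qed
qed

section \<open>The distance of a star product\<close>

locale star =
  fixes I :: "'i set" and G :: "'i \<Rightarrow> 'a pair_pre_digraph" and ov :: "'i \<Rightarrow> 'a"
  assumes finite_I: "finite I"
    and factor: "j \<in> I \<Longrightarrow> connected_pair_digraph (G j)"
    and base: "j \<in> I \<Longrightarrow> ov j \<in> pverts (G j)"
begin

abbreviation S :: "('i \<times> 'a) set pair_pre_digraph" where
  "S \<equiv> star_product I G ov"

definition emb :: "'i \<Rightarrow> 'a \<Rightarrow> ('i \<times> 'a) set" where
  "emb j x = glue_class ((\<lambda>j. (j, ov j)) ` I) (j, x)"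

text \<open>
  Vertices of the star product are glue classes: the common vertex, and singletons for all the
  others. So a vertex that is not of the form \<open>{(j, x)}\<close> lies outside the \<open>j\<close>-th factor or is the
  common vertex, and the retraction sends it to \<open>ov j\<close> in either case. If \<open>j\<close> is the only index,
  the common vertex is the singleton \<open>{(j, ov j)}\<close>, and the first branch gives the same value.
\<close>

definition retr :: "'i \<Rightarrow> ('i \<times> 'a) set \<Rightarrow> 'a" where
  "retr j p = (if \<exists>x. p = {(j, x)} then THE x. p = {(j, x)} else ov j)"

lemma pverts_star: "pverts S = {emb j x |j x. j \<in> I \<and> x \<in> pverts (G j)}"
  by (auto simp: star_product_def glue_graph_def disjoint_union_graph_def emb_def)

lemma parcs_star: "parcs S = {(emb j x, emb j y) |j x y. j \<in> I \<and> (x, y) \<in> parcs (G j)}"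
  by (force simp: star_product_def glue_graph_def disjoint_union_graph_def emb_def)

lemma emb_base:
  assumes "i \<in> I" "j \<in> I"
  shows "emb i (ov i) = emb j (ov j)"
  using assms by (simp add: emb_def glue_class_def)

lemma retr_emb:
  assumes "i \<in> I"
  shows "retr j (emb i x) = (if i = j then x else ov j)"
proof (cases "x = ov i")
  case True
  then have "emb i x = (\<lambda>j. (j, ov j)) ` I"
    using assms by (simp add: emb_def glue_class_def)
  moreover have "y = ov j" if "(\<lambda>j. (j, ov j)) ` I = {(j, y)}" for y
    using that by auto
  ultimately have "retr j (emb i x) = ov j"
    by (auto simp: retr_def)
  then show ?thesis using True by simp
next
  case False
  then have "emb i x = {(i, x)}"
    by (auto simp: emb_def glue_class_def)
  then show ?thesis by (auto simp: retr_def)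
qed

lemma emb_in: "\<lbrakk>j \<in> I; x \<in> pverts (G j)\<rbrakk> \<Longrightarrow> emb j x \<in> pverts S"
  by (auto simp: pverts_star)

lemma emb_arc: "\<lbrakk>j \<in> I; (x, y) \<in> parcs (G j)\<rbrakk> \<Longrightarrow> (emb j x, emb j y) \<in> parcs S"
  by (auto simp: parcs_star)

lemma retr_in: "\<lbrakk>j \<in> I; p \<in> pverts S\<rbrakk> \<Longrightarrow> retr j p \<in> pverts (G j)"
  by (auto simp: pverts_star retr_emb base)

lemma connected_star: "connected_pair_digraph S"
proof
  fix e assume e: "e \<in> parcs S"
  then obtain j x y where *: "e = (emb j x, emb j y)" "j \<in> I" "(x, y) \<in> parcs (G j)"
    by (auto simp: parcs_star)
  interpret G: connected_pair_digraph "G j" using factor *(2) .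
  show "fst e \<in> pverts S" "snd e \<in> pverts S"
    using * G.in_arcsD1 G.in_arcsD2 by (auto intro: emb_in)
next
  fix p q assume "p \<in> pverts S" "q \<in> pverts S"
  then obtain i x j y where p: "p = emb i x" "i \<in> I" "x \<in> pverts (G i)"
    and q: "q = emb j y" "j \<in> I" "y \<in> pverts (G j)"
    by (auto simp: pverts_star)
  have lift: "(emb k u, emb k v) \<in> (parcs S)\<^sup>*"
    if k: "k \<in> I" "u \<in> pverts (G k)" "v \<in> pverts (G k)" for k u v
  proof -
    interpret G: connected_pair_digraph "G k" using factor k(1) .
    from G.walk_ex[OF k(2,3)] show ?thesis
      by (induction rule: rtrancl_induct) (auto dest: emb_arc[OF k(1)] intro: rtrancl_into_rtrancl)
  qed
  have "(p, emb i (ov i)) \<in> (parcs S)\<^sup>*" "(emb j (ov j), q) \<in> (parcs S)\<^sup>*"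
    using lift p q base by auto
  then show "(p, q) \<in> (parcs S)\<^sup>*"
    using emb_base[OF p(2) q(2)] by simp
qed

text \<open>
  The right-hand side satisfies the triangle inequality, and it is at most 1 on arcs since an arc
  of the star product is kept apart by at most one of the retractions; so it is a lower bound. It is
  attained by walking from \<open>p\<close> to the common vertex and from there to \<open>q\<close>, or directly if both
  vertices lie in the same factor.
\<close>

theorem gdist_star:
  assumes p: "p \<in> pverts S" and q: "q \<in> pverts S"
  shows "gdist S p q = (\<Sum>k\<in>I. gdist (G k) (retr k p) (retr k q))"
proof (rule antisym)
  interpret S: connected_pair_digraph S by (rule connected_star)
  note refl = connected_pair_digraph.gdist_refl[OF factor]
  obtain i x j y where px: "p = emb i x" "i \<in> I" "x \<in> pverts (G i)"
    and qy: "q = emb j y" "j \<in> I" "y \<in> pverts (G j)"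
    using p q by (auto simp: pverts_star)
  have emb_le: "gdist S (emb k u) (emb k v) \<le> gdist (G k) u v"
    if "k \<in> I" "u \<in> pverts (G k)" "v \<in> pverts (G k)" for k u v
    by (rule connected_pair_digraph.gdist_hom_le[OF factor[OF that(1)] connected_star])
       (use that in \<open>auto intro: emb_in emb_arc\<close>)
  show "gdist S p q \<le> (\<Sum>k\<in>I. gdist (G k) (retr k p) (retr k q))"
  proof (cases "i = j")
    case True
    have "(\<Sum>k\<in>I. gdist (G k) (retr k p) (retr k q)) = (\<Sum>k\<in>I. if k = i then gdist (G i) x y else 0)"
      using True by (intro sum.cong) (auto simp: px qy retr_emb refl base)
    also have "\<dots> = gdist (G i) x y"
      using px(2) finite_I by simp
    finally show ?thesis
      using emb_le[OF px(2,3), of y] True by (simp add: px(1) qy(1,3))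
  next
    case False
    have "(\<Sum>k\<in>I. gdist (G k) (retr k p) (retr k q))
        = (\<Sum>k\<in>I. (if k = i then gdist (G i) x (ov i) else 0)
                + (if k = j then gdist (G j) (ov j) y else 0))"
      using False by (intro sum.cong) (auto simp: px qy retr_emb refl base)
    also have "\<dots> = gdist (G i) x (ov i) + gdist (G j) (ov j) y"
      using px(2) qy(2) finite_I by (simp add: sum.distrib)
    also have "\<dots> \<ge> gdist S (emb i x) (emb i (ov i)) + gdist S (emb j (ov j)) (emb j y)"
      using emb_le px qy base by (intro add_mono) auto
    moreover have "gdist S (emb i x) (emb i (ov i)) + gdist S (emb j (ov j)) (emb j y)
                   \<ge> gdist S p q"
      using S.gdist_triangle[OF p emb_in[OF px(2) base[OF px(2)]] q]
      by (simp add: px(1) qy(1) emb_base[OF px(2) qy(2)])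
    ultimately show ?thesis by linarith
  qed
  show "(\<Sum>k\<in>I. gdist (G k) (retr k p) (retr k q)) \<le> gdist S p q"
  proof (rule S.le_gdist[OF _ _ _ p q])
    fix p assume "p \<in> pverts S"
    then show "(\<Sum>k\<in>I. gdist (G k) (retr k p) (retr k p)) \<le> 0"
      by (simp add: refl retr_in)
  next
    fix p q assume "(p, q) \<in> parcs S"
    then obtain j x y where *: "p = emb j x" "q = emb j y" "j \<in> I" "(x, y) \<in> parcs (G j)"
      by (auto simp: parcs_star)
    have "(\<Sum>k\<in>I. gdist (G k) (retr k p) (retr k q)) = (\<Sum>k\<in>I. if k = j then gdist (G j) x y else 0)"
      by (intro sum.cong) (auto simp: * retr_emb refl base)
    also have "\<dots> = gdist (G j) x y"
      using *(3) finite_I by simp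
    also have "\<dots> \<le> 1"
      by (rule connected_pair_digraph.gdist_arc[OF factor[OF *(3)] *(4)])
    finally show "(\<Sum>k\<in>I. gdist (G k) (retr k p) (retr k q)) \<le> 1" .
  next
    fix p q r assume "p \<in> pverts S" "q \<in> pverts S" "r \<in> pverts S"
    then show "(\<Sum>k\<in>I. gdist (G k) (retr k p) (retr k r))
        \<le> (\<Sum>k\<in>I. gdist (G k) (retr k p) (retr k q)) + (\<Sum>k\<in>I. gdist (G k) (retr k q) (retr k r))"
      unfolding sum.distrib[symmetric]
      by (intro sum_mono connected_pair_digraph.gdist_triangle factor retr_in)
  qed
qed

corollary gdist_emb:
  assumes "j \<in> I" "x \<in> pverts (G j)" "y \<in> pverts (G j)"
  shows "gdist S (emb j x) (emb j y) = gdist (G j) x y"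
proof -
  have "gdist S (emb j x) (emb j y) = (\<Sum>k\<in>I. if k = j then gdist (G j) x y else 0)"
    unfolding gdist_star[OF emb_in[OF assms(1,2)] emb_in[OF assms(1,3)]]
    by (intro sum.cong)
       (auto simp: assms retr_emb base connected_pair_digraph.gdist_refl[OF factor])
  then show ?thesis using assms(1) finite_I by simp
qed

end

section \<open>Quadratic forms of distance matrices\<close>

lemma pairing_eq_sum:
  assumes "finite A" "A \<subseteq> V" "\<And>x. x \<in> V - A \<Longrightarrow> f x * g x = 0"
  shows "pairing V f g = (\<Sum>x\<in>A. f x * g x)"
proof -
  have "pairing V f g = (\<Sum>\<^sub>\<infinity>x\<in>A. f x * g x)"
    unfolding pairing_def using assms by (intro infsum_cong_neutral) auto
  then show ?thesis using assms(1) by simp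
qed

lemma pairing_dist_op_eq_sum:
  assumes A: "finite A" "A \<subseteq> pverts G" and f: "\<And>x. x \<notin> A \<Longrightarrow> f x = 0"
  shows "pairing (pverts G) f (dist_op G f) = (\<Sum>x\<in>A. \<Sum>y\<in>A. f x * f y * gdist G x y)"
proof -
  have "dist_op G f x = (\<Sum>y\<in>A. gdist G x y * f y)" for x
  proof -
    have "dist_op G f x = (\<Sum>\<^sub>\<infinity>y\<in>A. gdist G x y * f y)"
      unfolding dist_op_def using A f by (intro infsum_cong_neutral) auto
    then show ?thesis using A(1) by simp
  qed
  then show ?thesis
    using pairing_eq_sum[OF A, of f "dist_op G f"] f
    by (simp add: sum_distrib_left algebra_simps)
qed

text \<open>
  Expanding \<open>\<parallel>a x - a y\<parallel>\<^sup>2 = \<parallel>a x\<parallel>\<^sup>2 + \<parallel>a y\<parallel>\<^sup>2 - 2 \<langle>a x, a y\<rangle>\<close>, the first two terms contribute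
  nothing since each leaves a free sum over \<open>f\<close>, and the third is a Gram form. This is the easy
  half of Schoenberg's criterion.
\<close>

lemma sum_sq_dist_eq:
  fixes a :: "'b \<Rightarrow> 'h::real_inner" and f :: "'b \<Rightarrow> real"
  assumes zero: "sum f A = 0"
  shows "(\<Sum>x\<in>A. \<Sum>y\<in>A. f x * f y * (norm (a x - a y))\<^sup>2) = - 2 * (norm (\<Sum>x\<in>A. f x *\<^sub>R a x))\<^sup>2"
proof -
  have "(\<Sum>x\<in>A. \<Sum>y\<in>A. f x * f y * (norm (a x - a y))\<^sup>2)
      = (\<Sum>x\<in>A. \<Sum>y\<in>A. (f x * inner (a x) (a x)) * f y + f x * (f y * inner (a y) (a y))
                        - 2 * (f x * f y * inner (a x) (a y)))"
    by (intro sum.cong refl)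
       (simp add: power2_norm_eq_inner inner_diff_left inner_diff_right inner_commute algebra_simps)
  also have "\<dots> = (\<Sum>x\<in>A. f x * inner (a x) (a x)) * sum f A + sum f A * (\<Sum>y\<in>A. f y * inner (a y) (a y))
                  - 2 * (\<Sum>x\<in>A. \<Sum>y\<in>A. f x * f y * inner (a x) (a y))"
    by (simp add: sum.distrib sum_subtractf flip: sum_distrib_left sum_distrib_right)
  also have "(\<Sum>x\<in>A. \<Sum>y\<in>A. f x * f y * inner (a x) (a y)) = (norm (\<Sum>x\<in>A. f x *\<^sub>R a x))\<^sup>2"
    by (simp add: power2_norm_eq_inner inner_sum_left inner_sum_right mult.assoc)
       (subst sum.swap, simp add: inner_commute mult.left_commute sum_distrib_left)
  finally show ?thesis by (simp add: zero)
qed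

text \<open>
  The points \<open>a x\<close> may repeat. This lets a function on the star product be tested against one
  factor through the retraction, without first collecting its values on the fibres.
\<close>

lemma qe_class_form_nonpos:
  fixes f :: "'b \<Rightarrow> real"
  assumes "qe_class TYPE('h::{real_inner,complete_space}) G"
    and a: "\<And>x. x \<in> A \<Longrightarrow> a x \<in> pverts G" and zero: "sum f A = 0"
  shows "(\<Sum>x\<in>A. \<Sum>y\<in>A. f x * f y * gdist G (a x) (a y)) \<le> 0"
proof -
  obtain \<phi> :: "_ \<Rightarrow> 'h"
    where \<phi>: "\<And>x y. \<lbrakk>x \<in> pverts G; y \<in> pverts G\<rbrakk> \<Longrightarrow> (norm (\<phi> x - \<phi> y))\<^sup>2 = gdist G x y"
    using assms(1) unfolding qe_class_def by blast
  have "(\<Sum>x\<in>A. \<Sum>y\<in>A. f x * f y * gdist G (a x) (a y))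
      = (\<Sum>x\<in>A. \<Sum>y\<in>A. f x * f y * (norm (\<phi> (a x) - \<phi> (a y)))\<^sup>2)"
    by (intro sum.cong refl) (simp add: \<phi> a)
  then show ?thesis using sum_sq_dist_eq[OF zero, of "\<lambda>x. \<phi> (a x)"] by simp
qed

section \<open>Bounds for the QE constant\<close>

theorem QEC_isometric_mono:
  assumes inj: "inj_on h (pverts G)" and verts: "h ` pverts G \<subseteq> pverts H"
    and isom: "\<And>x y. \<lbrakk>x \<in> pverts G; y \<in> pverts G\<rbrakk> \<Longrightarrow> gdist H (h x) (h y) = gdist G x y"
  shows "QEC G \<le> QEC H"
  unfolding QEC_def
proof (rule SUP_mono)
  fix f assume "f \<in> {f \<in> fin_supp_funs (pverts G).
      pairing (pverts G) f f = 1 \<and> pairing (pverts G) (\<lambda>_. 1) f = 0}"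
  then have f: "f \<in> fin_supp_funs (pverts G)" "pairing (pverts G) f f = 1"
    "pairing (pverts G) (\<lambda>_. 1) f = 0" by auto
  define A where "A = {x. f x \<noteq> 0}"
  have A: "finite A" "A \<subseteq> pverts G" and fA: "\<And>x. x \<notin> A \<Longrightarrow> f x = 0"
    using f(1) by (auto simp: A_def fin_supp_funs_def)
  define g where "g y = (if y \<in> h ` A then f (the_inv_into (pverts G) h y) else 0)" for y
  have gh: "g (h x) = f x" if "x \<in> A" for x
    using that A(2) by (auto simp: g_def the_inv_into_f_f[OF inj])
  have g0: "g y = 0" if "y \<notin> h ` A" for y
    using that by (simp add: g_def)
  have hA: "finite (h ` A)" "h ` A \<subseteq> pverts H" "inj_on h A"
    using A verts inj by (auto intro: inj_on_subset)
  have "g \<in> fin_supp_funs (pverts H)"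
  proof -
    have "{y. g y \<noteq> 0} \<subseteq> h ` A" using g0 by blast
    then show ?thesis using hA unfolding fin_supp_funs_def by (auto intro: finite_subset)
  qed
  moreover have "pairing (pverts H) g g = pairing (pverts G) f f"
    using pairing_eq_sum[OF hA(1,2), of g g] pairing_eq_sum[OF A, of f f]
    by (simp add: g0 fA sum.reindex[OF hA(3)] gh)
  moreover have "pairing (pverts H) (\<lambda>_. 1) g = pairing (pverts G) (\<lambda>_. 1) f"
    using pairing_eq_sum[OF hA(1,2), of "\<lambda>_. 1" g] pairing_eq_sum[OF A, of "\<lambda>_. 1" f]
    by (simp add: g0 fA sum.reindex[OF hA(3)] gh)
  moreover have "pairing (pverts H) g (dist_op H g) = pairing (pverts G) f (dist_op G f)"
  proof -
    have "pairing (pverts H) g (dist_op H g)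
        = (\<Sum>x\<in>A. \<Sum>y\<in>A. g (h x) * g (h y) * gdist H (h x) (h y))"
      using pairing_dist_op_eq_sum[OF hA(1,2), of g] by (simp add: g0 sum.reindex[OF hA(3)])
    also have "\<dots> = (\<Sum>x\<in>A. \<Sum>y\<in>A. f x * f y * gdist G x y)"
      by (intro sum.cong refl) (simp add: gh isom subsetD[OF A(2)])
    finally show ?thesis using pairing_dist_op_eq_sum[OF A, of f] fA by simp
  qed
  ultimately show "\<exists>g\<in>{f \<in> fin_supp_funs (pverts H).
      pairing (pverts H) f f = 1 \<and> pairing (pverts H) (\<lambda>_. 1) f = 0}.
      ereal (pairing (pverts G) f (dist_op G f)) \<le> ereal (pairing (pverts H) g (dist_op H g))"
    using f(2,3) by (intro bexI[of _ g]) auto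
qed

context star
begin

lemma QEC_factor_le:
  assumes "j \<in> I"
  shows "QEC (G j) \<le> QEC S"
proof (rule QEC_isometric_mono)
  show "inj_on (emb j) (pverts (G j))"
    by (rule inj_on_inverseI[where g = "retr j"]) (simp add: retr_emb assms)
qed (auto simp: assms emb_in gdist_emb)

text \<open>
  Additivity of the distance splits the form on the star product into one form per factor, each
  nonpositive by the Gram identity.
\<close>

lemma QEC_star_nonpos:
  assumes qe: "\<And>j. j \<in> I \<Longrightarrow> qe_class TYPE('h::{real_inner,complete_space}) (G j)"
  shows "QEC S \<le> 0"
  unfolding QEC_def
proof (rule SUP_least)
  fix f assume "f \<in> {f \<in> fin_supp_funs (pverts S).
      pairing (pverts S) f f = 1 \<and> pairing (pverts S) (\<lambda>_. 1) f = 0}"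
  then have f: "f \<in> fin_supp_funs (pverts S)" "pairing (pverts S) (\<lambda>_. 1) f = 0" by auto
  define A where "A = {p. f p \<noteq> 0}"
  have A: "finite A" "A \<subseteq> pverts S" and fA: "\<And>p. p \<notin> A \<Longrightarrow> f p = 0"
    using f(1) by (auto simp: A_def fin_supp_funs_def)
  have zero: "sum f A = 0"
    using pairing_eq_sum[OF A, of "\<lambda>_. 1" f] f(2) fA by simp
  have "pairing (pverts S) f (dist_op S f) = (\<Sum>p\<in>A. \<Sum>q\<in>A. f p * f q * gdist S p q)"
    using A fA by (rule pairing_dist_op_eq_sum)
  also have "\<dots> = (\<Sum>p\<in>A. \<Sum>q\<in>A. \<Sum>k\<in>I. f p * f q * gdist (G k) (retr k p) (retr k q))"
    by (intro sum.cong refl) (simp add: gdist_star subsetD[OF A(2)] sum_distrib_left)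
  also have "\<dots> = (\<Sum>k\<in>I. \<Sum>p\<in>A. \<Sum>q\<in>A. f p * f q * gdist (G k) (retr k p) (retr k q))"
    by (simp add: sum.swap[of _ _ I])
  also have "\<dots> \<le> 0"
    using A(2) by (intro sum_nonpos qe_class_form_nonpos[OF qe _ zero] retr_in) auto
  finally show "ereal (pairing (pverts S) f (dist_op S f)) \<le> 0" by simp
qed

end

section \<open>Star products with a factor of QE constant 0\<close>

theorem theorem4p4:
  fixes r :: nat
    and G :: "nat \<Rightarrow> 'a pair_pre_digraph"
    and ov :: "nat \<Rightarrow> 'a"
    and Q :: "nat \<Rightarrow> ereal"
  assumes "r \<ge> 1"
    and "\<And>j. j \<in> {1..r} \<Longrightarrow> pair_bidirected_digraph (G j)"
    and "\<And>j. j \<in> {1..r} \<Longrightarrow> Digraph_Component.connected (with_proj (G j))"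
    and "\<And>j. j \<in> {1..r} \<Longrightarrow> infinite (pverts (G j)) \<or> card (pverts (G j)) \<ge> 2"
    and "\<And>j. j \<in> {1..r} \<Longrightarrow> ov j \<in> pverts (G j)"
    and "\<And>j. j \<in> {1..r} \<Longrightarrow> qe_class TYPE('h::{real_inner,complete_space}) (G j)"
    and "\<And>j. j \<in> {1..r} \<Longrightarrow> Q j = QEC (G j)"
    and "\<And>j. j \<in> {1..r} \<Longrightarrow> Q j \<le> 0"
    and "\<exists>j\<in>{1..r}. Q j = 0"
  shows "QEC (star_product {1..r} G ov) = 0"
proof -
  have factor: "connected_pair_digraph (G j)" if j: "j \<in> {1..r}" for j
  proof -
    interpret pair_bidirected_digraph "G j" by (rule assms(2)[OF j])
    show ?thesis
      using assms(3)[OF j] by (intro connected_pair_digraphI) unfold_locales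
  qed
  interpret star "{1..r}" G ov
    by (rule star.intro[OF finite_atLeastAtMost factor assms(5)])
  from assms(9) obtain j where j: "j \<in> {1..r}" "Q j = 0" by blast
  show ?thesis
  proof (rule antisym)
    show "QEC S \<le> 0" by (rule QEC_star_nonpos) (rule assms(6))
    show "0 \<le> QEC S" using QEC_factor_le[OF j(1)] assms(7)[OF j(1)] j(2) by simp
  qed
qed

end
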